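(* Let $n\ge 1$, let $\mathcal{C}\subset\mathbb{H}^n$ be a convex set and let $f:\mathcal{C}\to\mathbb{R}$ be a real-differentiable function. Then $f$ is convex if and only if for all $\boldsymbol{p},\boldsymbol{q}\in\mathcal{C}$, $$\mathrm{Re}\left\{\big(\nabla_{\boldsymbol{p}^*} f(\boldsymbol{p})-\nabla_{\boldsymbol{q}^*} f(\boldsymbol{q})\big)^{\mathsf{H}}(\boldsymbol{p}-\boldsymbol{q})\right\}\geqslant 0 .$$
   Context: $\mathbb{H}$ is the algebra of real quaternions $q=q_a+q_bi+q_cj+q_dk$ ($q_a,q_b,q_c,q_d\in\mathbb{R}$, $i^2=j^2=k^2=ijk=-1$), with $\mathrm{Re}\{q\}=q_a$ and conjugate $q^*=q_a-q_bi-q_cj-q_dk$. For a quaternion vector, $(\cdot)^{\mathsf{H}}$ is the conjugate transpose. A set $\mathcal{C}\subset\mathbb{H}^n$ is convex if $\theta\boldsymbol{x}+(1-\theta)\boldsymbol{y}\in\mathcal{C}$ for all $\boldsymbol{x},\boldsymbol{y}\in\mathcal{C}$ and real $0\le\theta\le1$. A function $f:\mathcal{C}\to\mathbb{R}$ is convex if $\mathcal{C}$ is convex and $f(\theta\boldsymbol{x}+(1-\theta)\boldsymbol{y})\le\theta f(\boldsymbol{x})+(1-\theta)f(\boldsymbol{y})$ for all $\boldsymbol{x},\boldsymbol{y}\in\mathcal{C}$, $0\le\theta\le1$. Real-differentiable means that $f$, viewed as a function of the $4n$ real components of $\boldsymbol{q}=\boldsymbol{q}_a+\boldsymbol{q}_bi+\boldsymbol{q}_cj+\boldsymbol{q}_dk$,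 is differentiable at every point of $\mathcal{C}$ ($f$ is defined only on $\mathcal{C}$, so the partial derivatives at points of $\mathcal{C}$ are the usual two-sided ones computed from the values of $f$ on $\mathcal{C}$). The (conjugate) quaternion gradient is the column vector $\nabla_{\boldsymbol{q}^*}f=\left(\frac{\partial f}{\partial q_1^*},\dots,\frac{\partial f}{\partial q_n^*}\right)^{\mathsf{T}}\in\mathbb{H}^n$, where $\frac{\partial f}{\partial q_l^*}=\frac14\left(\frac{\partial f}{\partial q_{l,a}}+\frac{\partial f}{\partial q_{l,b}}i+\frac{\partial f}{\partial q_{l,c}}j+\frac{\partial f}{\partial q_{l,d}}k\right)$ and $q_l=q_{l,a}+q_{l,b}i+q_{l,c}j+q_{l,d}k$. $\nabla_{\boldsymbol{p}^*}f(\boldsymbol{p})$ denotes this gradient evaluated at $\boldsymbol{p}$. *)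

theory Defs
  imports "HOL-Analysis.Analysis"
begin

section \<open>Quaternions\<close>

datatype quat = Quat (qRe: real) (qIm1: real) (qIm2: real) (qIm3: real)

lemma quat_eq_iff:
  "x = y \<longleftrightarrow> qRe x = qRe y \<and> qIm1 x = qIm1 y \<and> qIm2 x = qIm2 y \<and> qIm3 x = qIm3 y"
  by (cases x; cases y) simp

instantiation quat :: ab_group_add
begin

definition zero_quat where "0 = Quat 0 0 0 0"

definition plus_quat where
  "x + y = Quat (qRe x + qRe y) (qIm1 x + qIm1 y) (qIm2 x + qIm2 y) (qIm3 x + qIm3 y)"

definition uminus_quat where
  "- x = Quat (- qRe x) (- qIm1 x) (- qIm2 x) (- qIm3 x)"

definition minus_quat where
  "x - y = Quat (qRe x - qRe y) (qIm1 x - qIm1 y) (qIm2 x - qIm2 y) (qIm3 x - qIm3 y)"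

instance
  by standard
    (auto simp: zero_quat_def plus_quat_def uminus_quat_def minus_quat_def quat_eq_iff)

end

lemma quat_zero_sel [simp]: "qRe 0 = 0" "qIm1 0 = 0" "qIm2 0 = 0" "qIm3 0 = 0"
  by (simp_all add: zero_quat_def)

lemma quat_add_sel [simp]:
  "qRe (x + y) = qRe x + qRe y" "qIm1 (x + y) = qIm1 x + qIm1 y"
  "qIm2 (x + y) = qIm2 x + qIm2 y" "qIm3 (x + y) = qIm3 x + qIm3 y"
  by (simp_all add: plus_quat_def)

lemma quat_uminus_sel [simp]:
  "qRe (- x) = - qRe x" "qIm1 (- x) = - qIm1 x"
  "qIm2 (- x) = - qIm2 x" "qIm3 (- x) = - qIm3 x"
  by (simp_all add: uminus_quat_def)

lemma quat_minus_sel [simp]: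
  "qRe (x - y) = qRe x - qRe y" "qIm1 (x - y) = qIm1 x - qIm1 y"
  "qIm2 (x - y) = qIm2 x - qIm2 y" "qIm3 (x - y) = qIm3 x - qIm3 y"
  by (simp_all add: minus_quat_def)

instantiation quat :: ring_1
begin

definition one_quat where "1 = Quat 1 0 0 0"

definition times_quat where
  "x * y = Quat
     (qRe x * qRe y - qIm1 x * qIm1 y - qIm2 x * qIm2 y - qIm3 x * qIm3 y)
     (qRe x * qIm1 y + qIm1 x * qRe y + qIm2 x * qIm3 y - qIm3 x * qIm2 y)
     (qRe x * qIm2 y - qIm1 x * qIm3 y + qIm2 x * qRe y + qIm3 x * qIm1 y)
     (qRe x * qIm3 y + qIm1 x * qIm2 y - qIm2 x * qIm1 y + qIm3 x * qRe y)"

instance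
  by standard (auto simp: one_quat_def times_quat_def quat_eq_iff algebra_simps)

end

lemma quat_one_sel [simp]: "qRe 1 = 1" "qIm1 1 = 0" "qIm2 1 = 0" "qIm3 1 = 0"
  by (simp_all add: one_quat_def)

lemma quat_times_sel [simp]:
  "qRe (x * y) = qRe x * qRe y - qIm1 x * qIm1 y - qIm2 x * qIm2 y - qIm3 x * qIm3 y"
  "qIm1 (x * y) = qRe x * qIm1 y + qIm1 x * qRe y + qIm2 x * qIm3 y - qIm3 x * qIm2 y"
  "qIm2 (x * y) = qRe x * qIm2 y - qIm1 x * qIm3 y + qIm2 x * qRe y + qIm3 x * qIm1 y"
  "qIm3 (x * y) = qRe x * qIm3 y + qIm1 x * qIm2 y - qIm2 x * qIm1 y + qIm3 x * qRe y"
  by (simp_all add: times_quat_def)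

instantiation quat :: real_algebra_1
begin

definition scaleR_quat where
  "r *\<^sub>R x = Quat (r * qRe x) (r * qIm1 x) (r * qIm2 x) (r * qIm3 x)"

instance
  by standard (auto simp: scaleR_quat_def quat_eq_iff algebra_simps)

end

lemma quat_scaleR_sel [simp]:
  "qRe (r *\<^sub>R x) = r * qRe x" "qIm1 (r *\<^sub>R x) = r * qIm1 x"
  "qIm2 (r *\<^sub>R x) = r * qIm2 x" "qIm3 (r *\<^sub>R x) = r * qIm3 x"
  by (simp_all add: scaleR_quat_def)

lemma quat_of_real_sel [simp]:
  "qRe (of_real r) = r" "qIm1 (of_real r) = 0" "qIm2 (of_real r) = 0" "qIm3 (of_real r) = 0"
  by (simp_all add: of_real_def)

text \<open>The norm and inner product are those of the coordinate space $\mathbb{R}^4$.\<close>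

instantiation quat :: real_inner
begin

definition inner_quat where
  "x \<bullet> y = qRe x * qRe y + qIm1 x * qIm1 y + qIm2 x * qIm2 y + qIm3 x * qIm3 y"

definition norm_quat where "norm (x :: quat) = sqrt (x \<bullet> x)"

definition sgn_quat where "sgn (x :: quat) = x /\<^sub>R norm x"

definition dist_quat where "dist (x :: quat) y = norm (x - y)"

definition uniformity_quat where
  "(uniformity :: (quat \<times> quat) filter) =
     (INF e\<in>{0 <..}. principal {(x, y). dist x y < e})"

definition open_quat where
  "open (U :: quat set) \<longleftrightarrow>
     (\<forall>x\<in>U. eventually (\<lambda>(x', y). x' = x \<longrightarrow> y \<in> U) uniformity)"

instance
proof
  fix x y z :: quat and r :: real and U :: "quat set"
  show "dist x y = norm (x - y)" by (rule dist_quat_def)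
  show "sgn x = x /\<^sub>R norm x" by (rule sgn_quat_def)
  show "(uniformity :: (quat \<times> quat) filter) =
     (INF e\<in>{0 <..}. principal {(x, y). dist x y < e})" by (rule uniformity_quat_def)
  show "open U \<longleftrightarrow> (\<forall>x\<in>U. \<forall>\<^sub>F (x', y) in uniformity. x' = x \<longrightarrow> y \<in> U)"
    by (rule open_quat_def)
  show "norm x = sqrt (x \<bullet> x)" by (rule norm_quat_def)
  show "x \<bullet> y = y \<bullet> x" by (simp add: inner_quat_def mult.commute)
  show "(x + y) \<bullet> z = x \<bullet> z + y \<bullet> z" by (simp add: inner_quat_def algebra_simps)
  show "(r *\<^sub>R x) \<bullet> y = r * (x \<bullet> y)" by (simp add: inner_quat_def algebra_simps)
  show "0 \<le> x \<bullet> x" by (simp add: inner_quat_def)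
  show "x \<bullet> x = 0 \<longleftrightarrow> x = 0"
    by (simp add: inner_quat_def quat_eq_iff add_nonneg_eq_0_iff)
qed

end

definition qi :: quat where "qi = Quat 0 1 0 0"
definition qj :: quat where "qj = Quat 0 0 1 0"
definition qk :: quat where "qk = Quat 0 0 0 1"

lemma quat_unit_sel [simp]:
  "qRe qi = 0" "qIm1 qi = 1" "qIm2 qi = 0" "qIm3 qi = 0"
  "qRe qj = 0" "qIm1 qj = 0" "qIm2 qj = 1" "qIm3 qj = 0"
  "qRe qk = 0" "qIm1 qk = 0" "qIm2 qk = 0" "qIm3 qk = 1"
  by (simp_all add: qi_def qj_def qk_def)

lemma quat_hamilton: "qi * qi = - 1" "qj * qj = - 1" "qk * qk = - 1" "qi * qj * qk = - 1"
  by (simp_all add: quat_eq_iff)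

lemma quat_decompose:
  "q = of_real (qRe q) + of_real (qIm1 q) * qi + of_real (qIm2 q) * qj + of_real (qIm3 q) * qk"
  by (simp add: quat_eq_iff)

instantiation quat :: euclidean_space
begin

definition Basis_quat where "Basis = {1, qi, qj, qk}"

instance
proof
  show "(Basis :: quat set) \<noteq> {}" "finite (Basis :: quat set)"
    by (simp_all add: Basis_quat_def)
  have ne: "1 \<noteq> qi" "1 \<noteq> qj" "1 \<noteq> qk" "qi \<noteq> qj" "qi \<noteq> qk" "qj \<noteq> qk"
    by (simp_all add: quat_eq_iff)
  show "u \<bullet> v = (if u = v then 1 else 0)" if "u \<in> Basis" "v \<in> Basis" for u v :: quat
    using that ne ne[symmetric] unfolding Basis_quat_def
    by (elim insertE emptyE) (simp_all add: inner_quat_def)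
  show "(\<forall>u\<in>Basis. x \<bullet> u = 0) \<longleftrightarrow> x = 0" for x :: quat
    unfolding Basis_quat_def ball_simps by (simp add: inner_quat_def quat_eq_iff[of x])
qed

end

definition qcnj :: "quat \<Rightarrow> quat" where
  "qcnj q = Quat (qRe q) (- qIm1 q) (- qIm2 q) (- qIm3 q)"

text \<open>The product $u^{\mathsf{H}} v$ of two column vectors.\<close>

definition qherm :: "quat ^ 'n \<Rightarrow> quat ^ 'n \<Rightarrow> quat" where
  "qherm u v = (\<Sum>l\<in>UNIV. qcnj (u $ l) * (v $ l))"


section \<open>Real differentiability and the conjugate gradient\<close>

text \<open>
  A function on a subset \<open>C\<close> of $\mathbb{H}^n$ is represented by a total function whose values
  outside \<open>C\<close> are irrelevant. The real coordinate \<open>q\<^sub>l\<^sub>,\<^sub>a\<close> (respectively \<open>b\<close>, \<open>c\<close>, \<open>d\<close>) of a vector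
  corresponds to the direction \<open>axis l u\<close> with \<open>u = 1\<close> (respectively \<open>qi\<close>, \<open>qj\<close>, \<open>qk\<close>).
\<close>

definition qpartial :: "quat \<Rightarrow> 'n \<Rightarrow> (quat ^ 'n \<Rightarrow> real) \<Rightarrow> quat ^ 'n \<Rightarrow> real" where
  "qpartial u l f p = deriv (\<lambda>t. f (p + t *\<^sub>R axis l u)) 0"

text \<open>
  The clause on \<open>e\<close> says that \<open>C\<close> contains a two-sided segment through \<open>p\<close> along every real
  coordinate line, so that the two-sided partial derivatives are determined by the values on \<open>C\<close>.
\<close>

definition real_differentiable_on :: "(quat ^ 'n \<Rightarrow> real) \<Rightarrow> (quat ^ 'n) set \<Rightarrow> bool" where
  "real_differentiable_on f C \<longleftrightarrow>
     (\<forall>p\<in>C. f differentiable (at p within C) \<and>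
        (\<forall>l. \<forall>u\<in>{1, qi, qj, qk}. \<exists>e>0. \<forall>t. \<bar>t\<bar> < e \<longrightarrow> p + t *\<^sub>R axis l u \<in> C))"

definition qgrad :: "(quat ^ 'n \<Rightarrow> real) \<Rightarrow> quat ^ 'n \<Rightarrow> quat ^ 'n" where
  "qgrad f p = (\<chi> l. (1 / 4) *\<^sub>R
     (of_real (qpartial 1 l f p) + of_real (qpartial qi l f p) * qi
      + of_real (qpartial qj l f p) * qj + of_real (qpartial qk l f p) * qk))"

end

theory Submission imports Defs begin

text \<open>
  The coordinate segments through a point \<open>p\<close> of \<open>C\<close> determine the derivative \<open>D\<close> of \<open>f\<close> at \<open>p\<close>
  within \<open>C\<close>: on each coordinate direction \<open>D\<close> equals the two-sided partial derivative, so by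
  linearity \<open>D h\<close> is the real pairing of \<open>h\<close> with the vector of partial derivatives. The quaternion
  gradient packs these partial derivatives with the factor \<open>1 / 4\<close>, and the real part of a Hermitian
  product is the Euclidean inner product; hence \<open>D h = 4 * qRe (qherm (qgrad f p) h)\<close>
  (\<open>has_derivative_qgrad\<close>).

  The inequality is therefore, up to the positive factor 4, monotonicity of the derivative, and
  the statement is an instance of the fact that a differentiable function on a convex subset of a
  real normed space is convex exactly when its derivative is monotone (\<open>convex_on_iff_mono_deriv\<close>).
  That fact is one-dimensional, because only the restrictions of the function to segments of \<open>C\<close>
  matter: a convex function lies above its tangents, and adding the tangent inequalities at the two
  ends of a segment gives monotonicity; conversely the mean value theorem turns monotonicity into
  an increase of the slopes of successive chords. The derivatives are taken within \<open>C\<close> and within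
  the unit interval, so that the segments may be used up to their end points.
\<close>

lemma has_derivative_along_segment:
  fixes f :: "'a::real_normed_vector \<Rightarrow> real"
  assumes "convex C" and x: "x \<in> C" and y: "y \<in> C"
    and D: "\<And>z. z \<in> C \<Longrightarrow> (f has_derivative D z) (at z within C)"
    and t: "t \<in> {0..1}"
  shows "((\<lambda>t. f (x + t *\<^sub>R (y - x))) has_derivative (\<lambda>h. h * D (x + t *\<^sub>R (y - x)) (y - x)))
           (at t within {0..1})"
proof -
  have seg: "x + s *\<^sub>R (y - x) \<in> C" if "s \<in> {0..1}" for s
    using convexD_alt[OF \<open>convex C\<close> x y, of s] that by (simp add: algebra_simps)
  let ?z = "x + t *\<^sub>R (y - x)"
  have 1: "((\<lambda>t. x + t *\<^sub>R (y - x)) has_derivative (\<lambda>h. h *\<^sub>R (y - x))) (at t within {0..1})"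
    by (auto intro!: derivative_eq_intros)
  have 2: "(f has_derivative D ?z) (at ?z within (\<lambda>t. x + t *\<^sub>R (y - x)) ` {0..1})"
    by (rule has_derivative_subset[OF D[OF seg[OF t]]]) (use seg in auto)
  have "D ?z (h *\<^sub>R (y - x)) = h * D ?z (y - x)" for h
    using D[OF seg[OF t]] by (simp add: has_derivative_linear linear_scale)
  then show ?thesis
    using has_derivative_in_compose[OF 1 2] by simp
qed

text \<open>
  The slopes of the chords from \<open>x\<close> towards \<open>y\<close> are bounded by the slope of the whole chord, and
  the directional derivative is their limit.
\<close>

lemma convex_on_imp_above_derivative:
  fixes f :: "'a::real_normed_vector \<Rightarrow> real"
  assumes f: "convex_on C f" and x: "x \<in> C" and y: "y \<in> C"
    and D: "\<And>z. z \<in> C \<Longrightarrow> (f has_derivative D z) (at z within C)"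
  shows "D x (y - x) \<le> f y - f x"
proof -
  let ?g = "\<lambda>t. f (x + t *\<^sub>R (y - x))"
  have "(?g has_derivative (\<lambda>h. h * D x (y - x))) (at 0 within {0..1})"
    using has_derivative_along_segment[OF convex_on_imp_convex[OF f] x y D, of 0] by simp
  then have "(?g has_real_derivative D x (y - x)) (at 0 within {0..1})"
    by (simp add: has_field_derivative_def mult.commute[of _ "D x (y - x)"])
  then have "((\<lambda>t. (?g t - ?g 0) / (t - 0)) \<longlongrightarrow> D x (y - x)) (at 0 within {0..1})"
    by (simp add: has_field_derivative_iff)
  then have lim: "((\<lambda>t. (?g t - f x) / t) \<longlongrightarrow> D x (y - x)) (at_right 0)"
    by (simp add: at_within_Icc_at_right)
  have "\<forall>\<^sub>F t in at_right 0. (?g t - f x) / t \<le> f y - f x"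
    unfolding eventually_at_right_field
  proof (intro exI[of _ 1] conjI allI impI)
    fix t :: real assume t: "0 < t" "t < 1"
    have "?g t = f ((1 - t) *\<^sub>R x + t *\<^sub>R y)" by (simp add: algebra_simps)
    also have "\<dots> \<le> (1 - t) * f x + t * f y"
      using convex_onD[OF f, of t x y] t x y by simp
    finally show "(?g t - f x) / t \<le> f y - f x"
      using t by (simp add: field_simps)
  qed simp
  then show ?thesis
    using tendsto_upperbound[OF lim] by simp
qed

theorem convex_on_iff_mono_deriv:
  fixes f :: "'a::real_normed_vector \<Rightarrow> real"
  assumes C: "convex C"
    and D: "\<And>z. z \<in> C \<Longrightarrow> (f has_derivative D z) (at z within C)"
  shows "convex_on C f \<longleftrightarrow> (\<forall>p\<in>C. \<forall>q\<in>C. D q (p - q) \<le> D p (p - q))"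
proof
  assume f: "convex_on C f"
  show "\<forall>p\<in>C. \<forall>q\<in>C. D q (p - q) \<le> D p (p - q)"
  proof (intro ballI)
    fix p q assume p: "p \<in> C" and q: "q \<in> C"
    have "D p (q - p) = - D p (p - q)"
      using linear_neg[OF has_derivative_linear[OF D[OF p]], of "p - q"] by simp
    then show "D q (p - q) \<le> D p (p - q)"
      using convex_on_imp_above_derivative[OF f p q D] convex_on_imp_above_derivative[OF f q p D]
      by linarith
  qed
next
  assume mono: "\<forall>p\<in>C. \<forall>q\<in>C. D q (p - q) \<le> D p (p - q)"
  show "convex_on C f"
  proof (rule convex_onI[OF _ C])
    fix t :: real and x y assume t: "0 < t" "t < 1" and x: "x \<in> C" and y: "y \<in> C"
    let ?z = "\<lambda>s. x + s *\<^sub>R (y - x)"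
    let ?g = "\<lambda>s. f (?z s)"
    let ?g' = "\<lambda>s. D (?z s) (y - x)"
    have deriv: "(?g has_derivative (\<lambda>h. h * ?g' s)) (at s within {a..b})"
      if "0 \<le> a" "b \<le> 1" "a \<le> s" "s \<le> b" for a b s
      by (rule has_derivative_subset[OF has_derivative_along_segment[OF C x y D]])
        (use that in auto)
    obtain r where r: "0 < r" "r < t" "?g t - ?g 0 = (t - 0) * ?g' r"
      using mvt_simple[of 0 t ?g "\<lambda>s h. h * ?g' s"] deriv[of 0 t] t by auto
    obtain s where s: "t < s" "s < 1" "?g 1 - ?g t = (1 - t) * ?g' s"
      using mvt_simple[of t 1 ?g "\<lambda>s h. h * ?g' s"] deriv[of t 1] t by auto
    have zC: "?z a \<in> C" if "0 \<le> a" "a \<le> 1" for a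
      using convexD_alt[OF C x y, of a] that by (simp add: algebra_simps)
    have rs: "?z r \<in> C" "?z s \<in> C" using r s t by (auto intro!: zC)
    have diff: "?z s - ?z r = (s - r) *\<^sub>R (y - x)" by (simp add: algebra_simps)
    have "(s - r) * ?g' r \<le> (s - r) * ?g' s"
      using mono[rule_format, OF rs(2,1)] unfolding diff
      by (simp add: linear_scale[OF has_derivative_linear[OF D]] rs)
    then have "?g' r \<le> ?g' s" using r s by (simp add: mult_le_cancel_left)
    then have "t * (1 - t) * ?g' r \<le> t * (1 - t) * ?g' s"
      using t by (intro mult_left_mono) auto
    then have "(1 - t) * (?g t - ?g 0) \<le> t * (?g 1 - ?g t)"
      using r(3) s(3) by (simp add: mult_ac)
    then have "?g t \<le> (1 - t) * f x + t * f y" by (simp add: algebra_simps)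
    moreover have "?z t = (1 - t) *\<^sub>R x + t *\<^sub>R y" by (simp add: algebra_simps)
    ultimately show "f ((1 - t) *\<^sub>R x + t *\<^sub>R y) \<le> (1 - t) * f x + t * f y" by simp
  qed
qed

text \<open>
  Because \<open>C\<close> contains a neighbourhood of \<open>p\<close> on the line in direction \<open>v\<close>, a derivative within
  \<open>C\<close> still determines the two-sided derivative along that line.
\<close>

lemma deriv_along_line:
  fixes f :: "'a::real_normed_vector \<Rightarrow> real"
  assumes D: "(f has_derivative D) (at p within C)"
    and e: "0 < e" "\<And>t. \<bar>t\<bar> < e \<Longrightarrow> p + t *\<^sub>R v \<in> C"
  shows "deriv (\<lambda>t. f (p + t *\<^sub>R v)) 0 = D v"
proof -
  let ?I = "{-e<..<e}"
  have 1: "((\<lambda>t. p + t *\<^sub>R v) has_derivative (\<lambda>h. h *\<^sub>R v)) (at 0 within ?I)"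
    by (auto intro!: derivative_eq_intros)
  have "(f has_derivative D) (at (p + 0 *\<^sub>R v) within (\<lambda>t. p + t *\<^sub>R v) ` ?I)"
    unfolding scaleR_zero_left add_0_right
    by (rule has_derivative_subset[OF D]) (use e(2) in auto)
  from has_derivative_in_compose[OF 1 this]
  have "((\<lambda>t. f (p + t *\<^sub>R v)) has_derivative (\<lambda>h. D v * h)) (at 0 within ?I)"
    by (simp add: linear_scale[OF has_derivative_linear[OF D]] mult.commute)
  then have "((\<lambda>t. f (p + t *\<^sub>R v)) has_real_derivative D v) (at 0)"
    using e(1) by (simp add: has_field_derivative_def at_within_open[of _ ?I])
  then show ?thesis by (rule DERIV_imp_deriv)
qed

lemma vec_quat_expansion:
  fixes h :: "quat ^ 'n"
  shows "h = (\<Sum>l\<in>UNIV. qRe (h $ l) *\<^sub>R axis l 1 + qIm1 (h $ l) *\<^sub>R axis l qi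
                      + qIm2 (h $ l) *\<^sub>R axis l qj + qIm3 (h $ l) *\<^sub>R axis l qk)"
proof (subst vec_eq_iff, intro allI)
  fix m :: 'n
  have "(\<Sum>l\<in>UNIV. qRe (h $ l) *\<^sub>R axis l 1 + qIm1 (h $ l) *\<^sub>R axis l qi
            + qIm2 (h $ l) *\<^sub>R axis l qj + qIm3 (h $ l) *\<^sub>R axis l qk) $ m
      = (\<Sum>l\<in>UNIV. if l = m then h $ l else 0)"
    unfolding sum_component by (rule sum.cong) (auto simp: axis_def quat_eq_iff)
  then show "h $ m = (\<Sum>l\<in>UNIV. qRe (h $ l) *\<^sub>R axis l 1 + qIm1 (h $ l) *\<^sub>R axis l qi
            + qIm2 (h $ l) *\<^sub>R axis l qj + qIm3 (h $ l) *\<^sub>R axis l qk) $ m"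
    by simp
qed

lemma qRe_sum: "qRe (sum g A) = (\<Sum>a\<in>A. qRe (g a))"
  by (induction A rule: infinite_finite_induct) auto

lemma qRe_qherm: "qRe (qherm u v) = u \<bullet> v"
  by (simp add: qherm_def qRe_sum inner_vec_def inner_quat_def qcnj_def)

lemma has_derivative_qgrad:
  fixes C :: "(quat ^ 'n) set"
  assumes f: "real_differentiable_on f C" and p: "p \<in> C"
  shows "(f has_derivative (\<lambda>h. 4 * qRe (qherm (qgrad f p) h))) (at p within C)"
proof -
  obtain D where D: "(f has_derivative D) (at p within C)"
    using f p unfolding real_differentiable_on_def differentiable_def by blast
  have axis: "D (axis l u) = qpartial u l f p" if u: "u \<in> {1, qi, qj, qk}" for l u
  proof -
    obtain e where "e > 0" "\<And>t. \<bar>t\<bar> < e \<Longrightarrow> p + t *\<^sub>R axis l u \<in> C"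
      using f p u unfolding real_differentiable_on_def by blast
    from deriv_along_line[OF D this] show ?thesis by (simp add: qpartial_def)
  qed
  note lin = has_derivative_linear[OF D]
  have "D h = 4 * qRe (qherm (qgrad f p) h)" for h
  proof -
    have "D h = (\<Sum>l\<in>UNIV. qRe (h $ l) * qpartial 1 l f p + qIm1 (h $ l) * qpartial qi l f p
                      + qIm2 (h $ l) * qpartial qj l f p + qIm3 (h $ l) * qpartial qk l f p)"
      by (subst vec_quat_expansion[of h])
        (simp add: linear_sum[OF lin] linear_add[OF lin] linear_scale[OF lin] axis)
    also have "\<dots> = 4 * (qgrad f p \<bullet> h)"
      unfolding inner_vec_def sum_distrib_left
      by (rule sum.cong) (simp_all add: qgrad_def inner_quat_def algebra_simps)
    finally show ?thesis by (simp add: qRe_qherm)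
  qed
  then have "D = (\<lambda>h. 4 * qRe (qherm (qgrad f p) h))" by blast
  with D show ?thesis by simp
qed

theorem mainTheorem1:
  fixes C :: "(quat ^ 'n) set" and f :: "quat ^ 'n \<Rightarrow> real"
  assumes "convex C" and "real_differentiable_on f C"
  shows "convex_on C f \<longleftrightarrow>
    (\<forall>p\<in>C. \<forall>q\<in>C. qRe (qherm (qgrad f p - qgrad f q) (p - q)) \<ge> 0)"
  using convex_on_iff_mono_deriv[OF assms(1), where D = "\<lambda>z h. 4 * qRe (qherm (qgrad f z) h)",
      OF has_derivative_qgrad[OF assms(2)]]
  by (simp add: qRe_qherm inner_diff_left)

end
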